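(* Let $p,q\ge 2$ be integers and let $W$ be the word $W=ABA^pB^q$. Then there exist real symmetric positive definite matrices $A$ and $B$ (of the same size) such that $W(A,B)=ABA^pB^q$ has negative trace.
   Context: A word in the letters $A,B$ is interpreted as the matrix product obtained by substituting matrices for the letters; exponents denote repeated letters (matrix powers). *)

theory Defs
  imports Complex_Main "Jordan_Normal_Form.Matrix"
begin

datatype letter = LA | LB

fun subst_letter :: "'a mat \<Rightarrow> 'a mat \<Rightarrow> letter \<Rightarrow> 'a mat" where
  "subst_letter A B LA = A"
| "subst_letter A B LB = B"

(* The size n is needed only for the value of the empty word, the identity matrix. *)
definition eval_word :: "nat \<Rightarrow> letter list \<Rightarrow> 'a::semiring_1 mat \<Rightarrow> 'a mat \<Rightarrow> 'a mat" where
  "eval_word n w A B = foldr (\<lambda>l M. subst_letter A B l * M) w (1\<^sub>m n)"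

definition mat_trace :: "'a::comm_monoid_add mat \<Rightarrow> 'a" where
  "mat_trace M = (\<Sum>i<dim_row M. M $$ (i, i))"

definition sym_pos_def :: "nat \<Rightarrow> real mat \<Rightarrow> bool" where
  "sym_pos_def n A \<longleftrightarrow>
     A \<in> carrier_mat n n \<and> transpose_mat A = A \<and>
     (\<forall>v \<in> carrier_vec n. v \<noteq> 0\<^sub>v n \<longrightarrow> v \<bullet> (A *\<^sub>v v) > 0)"

definition word_ABApBq :: "nat \<Rightarrow> nat \<Rightarrow> letter list" where
  "word_ABApBq p q = [LA, LB] @ replicate p LA @ replicate q LB"

lemma funpow_mult_mat:
  assumes A: "A \<in> carrier_mat n n" and M: "M \<in> carrier_mat n n"
  shows "((*) A ^^ k) M = A ^\<^sub>m k * M"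
proof (induction k)
  case 0
  then show ?case using assms by simp
next
  case (Suc k)
  have comm: "A ^\<^sub>m k * A = A * A ^\<^sub>m k"
  proof (induction k)
    case 0
    then show ?case using A by simp
  next
    case (Suc k)
    then show ?case using A by (simp add: assoc_mult_mat[OF A pow_carrier_mat[OF A] A])
  qed
  show ?case
    using Suc by (simp add: comm assoc_mult_mat[OF A pow_carrier_mat[OF A] M])
qed

lemma eval_word_ABApBq:
  assumes A: "A \<in> carrier_mat n n" and B: "B \<in> carrier_mat n n"
  shows "eval_word n (word_ABApBq p q) A B = A * B * A ^\<^sub>m p * B ^\<^sub>m q"
proof -
  have pA: "A ^\<^sub>m p \<in> carrier_mat n n" and pB: "B ^\<^sub>m q \<in> carrier_mat n n"
    using assms by simp_all
  have "eval_word n (word_ABApBq p q) A B = A * (B * (A ^\<^sub>m p * B ^\<^sub>m q))"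
    by (simp add: right_mult_one_mat[OF pB] eval_word_def word_ABApBq_def funpow_mult_mat[OF A pB]
        funpow_mult_mat[OF B one_carrier_mat])
  also have "\<dots> = A * B * A ^\<^sub>m p * B ^\<^sub>m q"
    using assoc_mult_mat[OF A B mult_carrier_mat[OF pA pB]]
      assoc_mult_mat[OF mult_carrier_mat[OF A B] pA pB] by simp
  finally show ?thesis .
qed

end

theory Submission
  imports Defs
begin

text \<open>
  Perturbing by a small multiple of the identity turns positive semidefinite matrices into positive
  definite ones and changes the trace of a fixed word only slightly
  (\<open>negative_trace_from_semidef\<close>). So it suffices to find positive semidefinite \<open>A\<close>, \<open>B\<close> for which
  the trace is negative, and one pair of \<open>3 \<times> 3\<close> matrices serves all exponents.

  For \<open>A = diag(a)\<close> the trace is \<open>\<Sum> a\<^sub>i a\<^sub>j^p C\<^sub>i\<^sub>j\<close>, where \<open>C\<close> is the entrywise product of \<open>B\<close> and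
  \<open>B^q\<close>. The matrix \<open>C\<close> is positive semidefinite, but \<open>a\<close> and \<open>a^p\<close> are different vectors, so the
  sum may be negative once an off-diagonal entry of \<open>C\<close> is negative. With \<open>a = (1, t, 0)\<close> it is
  \<open>C\<^sub>1\<^sub>1 + (t + t^p) C\<^sub>1\<^sub>2 + t^(p+1) C\<^sub>2\<^sub>2\<close>. If \<open>C\<^sub>1\<^sub>2 < 0\<close>, a \<open>t\<close> of the order of \<open>C\<^sub>1\<^sub>1 / |C\<^sub>1\<^sub>2|\<close> makes
  the linear part negative. Since \<open>p + 1 \<ge> 3\<close>, the last term is then negligible as soon as \<open>t < 1\<close> and
  \<open>t\<^sup>3 C\<^sub>2\<^sub>2\<close> is small compared with \<open>C\<^sub>1\<^sub>1\<close>.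

  It remains to choose \<open>B\<close>. Take \<open>B = x x\<^sup>T + y y\<^sup>T\<close> with orthogonal \<open>x\<close>, \<open>y\<close> of squared lengths \<open>X\<close>,
  \<open>Y\<close>; then \<open>B^q = X^(q-1) x x\<^sup>T + Y^(q-1) y y\<^sup>T\<close> (\<open>outer_sum_power\<close>). Let the first two coordinates
  be \<open>(1, -2N)\<close> in \<open>x\<close> and \<open>(1, N)\<close> in \<open>y\<close>. Then \<open>B\<^sub>1\<^sub>2 = -N\<close>, whereas
  \<open>(B^q)\<^sub>1\<^sub>2 = N (Y^(q-1) - 2 X^(q-1))\<close> is positive when \<open>Y \<ge> 4 X\<close> and \<open>q \<ge> 2\<close>. The third coordinates
  \<open>1\<close> and \<open>2N\<^sup>2 - 1\<close> make \<open>x\<close> and \<open>y\<close> orthogonal and \<open>Y\<close> much larger than \<open>X\<close>. In units of \<open>Y^(q-1)\<close>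
  the entries \<open>C\<^sub>1\<^sub>1\<close>, \<open>-C\<^sub>1\<^sub>2\<close>, \<open>C\<^sub>2\<^sub>2\<close> have the orders \<open>1\<close>, \<open>N\<^sup>2\<close>, \<open>N\<^sup>4\<close>; so \<open>t = 10 / N\<^sup>2\<close> leaves
  \<open>t\<^sup>3 C\<^sub>2\<^sub>2\<close> of order \<open>1000 / N\<^sup>2\<close>, and \<open>N = 100\<close> is large enough for all the estimates
  (\<open>negative_form_value\<close>).
\<close>

section \<open>The trace of the word at a diagonal matrix\<close>

lemma pow_mat_diag: "(mat_diag n a :: real mat) ^\<^sub>m k = mat_diag n (\<lambda>i. a i ^ k)"
proof (induction k)
  case 0
  show ?case by (simp add: mat_diag_def one_mat_def)
next
  case (Suc k)
  then show ?case by (simp add: mat_diag_diag mult.commute)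
qed

lemma mat_trace_mult:
  assumes "M \<in> carrier_mat n n" "N \<in> carrier_mat n n"
  shows "mat_trace (M * N) = (\<Sum>i<n. \<Sum>j<n. M $$ (i, j) * N $$ (j, i))"
  using assms by (auto simp: mat_trace_def scalar_prod_def atLeast0LessThan intro!: sum.cong)

lemma mat_trace_word_diag:
  fixes B :: "real mat"
  assumes B: "B \<in> carrier_mat n n"
  shows "mat_trace (eval_word n (word_ABApBq p q) (mat_diag n a) B)
    = (\<Sum>i<n. \<Sum>j<n. a i * a j ^ p * (B $$ (i, j) * (B ^\<^sub>m q) $$ (j, i)))"
proof -
  have Bq: "B ^\<^sub>m q \<in> carrier_mat n n"
    using B by simp
  have D: "mat_diag n a \<in> carrier_mat n n"
    by simp
  have AB: "mat_diag n a * B * mat_diag n (\<lambda>i. a i ^ p)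
      = mat n n (\<lambda>(i, j). a i * B $$ (i, j) * a j ^ p)"
    using B by (auto simp: mat_diag_mult_left[OF B] mat_diag_mult_right[of _ n n])
  show ?thesis
    unfolding eval_word_ABApBq[OF D B] pow_mat_diag AB
    by (subst mat_trace_mult[OF _ Bq]) (auto intro!: sum.cong)
qed

section \<open>Powers of a sum of two orthogonal rank-one matrices\<close>

text \<open>The matrix \<open>\<alpha> x x\<^sup>T + \<beta> y y\<^sup>T\<close>. The two coefficients are kept as parameters because, for
  orthogonal \<open>x\<close> and \<open>y\<close>, matrices of this form are closed under multiplication.\<close>
definition outer_sum :: "nat \<Rightarrow> (nat \<Rightarrow> real) \<Rightarrow> (nat \<Rightarrow> real) \<Rightarrow> real \<Rightarrow> real \<Rightarrow> real mat" where
  "outer_sum n x y \<alpha> \<beta> = mat n n (\<lambda>(i, j). \<alpha> * (x i * x j) + \<beta> * (y i * y j))"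

lemma outer_sum_carrier [simp]: "outer_sum n x y \<alpha> \<beta> \<in> carrier_mat n n"
  by (simp add: outer_sum_def)

text \<open>Orthogonality kills the mixed terms, as \<open>x x\<^sup>T y y\<^sup>T = (x\<^sup>T y) x y\<^sup>T = 0\<close>, and
  \<open>x x\<^sup>T x x\<^sup>T = (x\<^sup>T x) x x\<^sup>T\<close>.\<close>
lemma outer_sum_mult:
  assumes "(\<Sum>l<n. x l * y l) = 0"
  shows "outer_sum n x y \<alpha> \<beta> * outer_sum n x y \<gamma> \<delta>
    = outer_sum n x y (\<alpha> * \<gamma> * (\<Sum>l<n. (x l)\<^sup>2)) (\<beta> * \<delta> * (\<Sum>l<n. (y l)\<^sup>2))"
proof -
  have "(\<Sum>l<n. (\<alpha> * (x i * x l) + \<beta> * (y i * y l)) * (\<gamma> * (x l * x j) + \<delta> * (y l * y j)))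
     = \<alpha> * \<gamma> * (\<Sum>l<n. (x l)\<^sup>2) * (x i * x j) + \<beta> * \<delta> * (\<Sum>l<n. (y l)\<^sup>2) * (y i * y j)" for i j
  proof -
    have "(\<Sum>l<n. (\<alpha> * (x i * x l) + \<beta> * (y i * y l)) * (\<gamma> * (x l * x j) + \<delta> * (y l * y j)))
      = (\<Sum>l<n. \<alpha> * \<gamma> * (x i * x j) * (x l)\<^sup>2 + \<beta> * \<delta> * (y i * y j) * (y l)\<^sup>2
          + (\<alpha> * \<delta> * (x i * y j) + \<beta> * \<gamma> * (y i * x j)) * (x l * y l))"
      by (rule sum.cong) (simp_all add: algebra_simps power2_eq_square)
    then show ?thesis
      using assms by (simp add: sum.distrib flip: sum_distrib_left)
  qed
  then show ?thesis
    by (auto simp: outer_sum_def scalar_prod_def atLeast0LessThan)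
qed

lemma outer_sum_power:
  assumes "(\<Sum>l<n. x l * y l) = 0"
  shows "outer_sum n x y 1 1 ^\<^sub>m Suc k
    = outer_sum n x y ((\<Sum>l<n. (x l)\<^sup>2) ^ k) ((\<Sum>l<n. (y l)\<^sup>2) ^ k)"
proof (induction k)
  case 0
  have "outer_sum n x y 1 1 ^\<^sub>m Suc 0 = 1\<^sub>m n * outer_sum n x y 1 1"
    by (simp add: outer_sum_def)
  then show ?case
    by (simp add: left_mult_one_mat[OF outer_sum_carrier])
next
  case (Suc k)
  show ?case
    by (subst pow_mat.simps(2), subst Suc.IH)
       (simp add: outer_sum_mult[OF assms] mult.commute)
qed

section \<open>From semidefinite to definite matrices\<close>

definition sym_pos_semidef :: "nat \<Rightarrow> real mat \<Rightarrow> bool" where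
  "sym_pos_semidef n A \<longleftrightarrow>
     A \<in> carrier_mat n n \<and> transpose_mat A = A \<and> (\<forall>v \<in> carrier_vec n. v \<bullet> (A *\<^sub>v v) \<ge> 0)"

text \<open>The quadratic form is \<open>(x\<^sup>T v)\<^sup>2 + (y\<^sup>T v)\<^sup>2\<close>.\<close>
lemma sym_pos_semidef_outer_sum:
  "sym_pos_semidef n (outer_sum n x y 1 1)"
proof -
  have "v \<bullet> (outer_sum n x y 1 1 *\<^sub>v v) \<ge> 0" if v: "v \<in> carrier_vec n" for v
  proof -
    have "v \<bullet> (outer_sum n x y 1 1 *\<^sub>v v)
        = (\<Sum>i<n. v $ i * (\<Sum>j<n. (x i * x j + y i * y j) * v $ j))"
      using v by (auto simp: outer_sum_def scalar_prod_def atLeast0LessThan intro!: sum.cong)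
    also have "\<dots> = (\<Sum>i<n. x i * v $ i)\<^sup>2 + (\<Sum>i<n. y i * v $ i)\<^sup>2"
      by (simp add: power2_eq_square sum_product sum_distrib_left algebra_simps sum.distrib)
    finally show ?thesis by simp
  qed
  moreover have "transpose_mat (outer_sum n x y 1 1) = outer_sum n x y 1 1"
    by (rule eq_matI) (auto simp: outer_sum_def)
  ultimately show ?thesis
    by (auto simp: sym_pos_semidef_def)
qed

lemma sym_pos_semidef_mat_diag:
  assumes "\<And>i. i < n \<Longrightarrow> a i \<ge> 0"
  shows "sym_pos_semidef n (mat_diag n a)"
proof -
  have "v \<bullet> (mat_diag n a *\<^sub>v v) \<ge> 0" if v: "v \<in> carrier_vec n" for v
  proof -
    have "v \<bullet> (mat_diag n a *\<^sub>v v) = (\<Sum>i<n. \<Sum>j<n. if i = j then a i * (v $ i)\<^sup>2 else 0)"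
      using v by (auto simp: mat_diag_def scalar_prod_def atLeast0LessThan sum_distrib_left
          power2_eq_square if_distrib[of "\<lambda>c. c * _"] if_distrib[of "\<lambda>c. _ * c"]
          cong: if_cong intro!: sum.cong)
    also have "\<dots> \<ge> 0"
      using assms by (intro sum_nonneg) auto
    finally show ?thesis .
  qed
  moreover have "transpose_mat (mat_diag n a) = mat_diag n a"
    by (rule eq_matI) (auto simp: mat_diag_def)
  ultimately show ?thesis
    by (auto simp: sym_pos_semidef_def)
qed

lemma sym_pos_def_shift:
  assumes A: "sym_pos_semidef n A" and e: "e > 0"
  shows "sym_pos_def n (A + e \<cdot>\<^sub>m 1\<^sub>m n)"
proof -
  have cA: "A \<in> carrier_mat n n" and tA: "transpose_mat A = A"
    using A by (auto simp: sym_pos_semidef_def)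
  have "v \<bullet> ((A + e \<cdot>\<^sub>m 1\<^sub>m n) *\<^sub>v v) > 0" if v: "v \<in> carrier_vec n" and nz: "v \<noteq> 0\<^sub>v n" for v
  proof -
    have "(e \<cdot>\<^sub>m 1\<^sub>m n) *\<^sub>v v = e \<cdot>\<^sub>v v"
      using v by (intro eq_vecI)
        (auto simp: scalar_prod_def atLeast0LessThan if_distrib[of "\<lambda>c. c * _"]
          if_distrib[of "\<lambda>c. _ * c"] cong: if_cong)
    then have "v \<bullet> ((A + e \<cdot>\<^sub>m 1\<^sub>m n) *\<^sub>v v) = v \<bullet> (A *\<^sub>v v) + e * (v \<bullet> v)"
      using v cA by (simp add: add_mult_distrib_mat_vec[of _ n n] scalar_prod_add_distrib[of _ n])
    moreover have "v \<bullet> v > 0"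
      using conjugate_square_greater_0_vec[OF v] nz by simp
    moreover have "v \<bullet> (A *\<^sub>v v) \<ge> 0"
      using A v by (auto simp: sym_pos_semidef_def)
    ultimately show ?thesis
      using e by (simp add: add_nonneg_pos)
  qed
  moreover have "transpose_mat (A + e \<cdot>\<^sub>m 1\<^sub>m n) = A + e \<cdot>\<^sub>m 1\<^sub>m n"
    using cA tA by (simp add: transpose_add[of _ n n]) (auto simp: one_mat_def)
  ultimately show ?thesis
    using cA by (auto simp: sym_pos_def_def)
qed

lemma eval_word_Cons:
  "eval_word n (l # w) A B = subst_letter A B l * eval_word n w A B"
  by (simp add: eval_word_def)

lemma subst_letter_carrier:
  assumes "A \<in> carrier_mat n n" "B \<in> carrier_mat n n"
  shows "subst_letter A B l \<in> carrier_mat n n"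
  using assms by (cases l) auto

lemma eval_word_carrier:
  assumes "A \<in> carrier_mat n n" "B \<in> carrier_mat n n"
  shows "eval_word n w A B \<in> carrier_mat n n"
proof (induction w)
  case Nil
  then show ?case by (simp add: eval_word_def)
next
  case (Cons l w)
  then show ?case
    unfolding eval_word_Cons using subst_letter_carrier[OF assms, of l] by simp
qed

lemma tendsto_eval_word_entry:
  fixes A B :: "real \<Rightarrow> real mat"
  assumes cA: "\<And>e. A e \<in> carrier_mat n n" and cB: "\<And>e. B e \<in> carrier_mat n n"
    and cA': "A' \<in> carrier_mat n n" and cB': "B' \<in> carrier_mat n n"
    and A: "\<And>i j. i < n \<Longrightarrow> j < n \<Longrightarrow> ((\<lambda>e. A e $$ (i, j)) \<longlongrightarrow> A' $$ (i, j)) F"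
    and B: "\<And>i j. i < n \<Longrightarrow> j < n \<Longrightarrow> ((\<lambda>e. B e $$ (i, j)) \<longlongrightarrow> B' $$ (i, j)) F"
    and ij: "i < n" "j < n"
  shows "((\<lambda>e. eval_word n w (A e) (B e) $$ (i, j)) \<longlongrightarrow> eval_word n w A' B' $$ (i, j)) F"
  using ij
proof (induction w arbitrary: i j)
  case Nil
  then show ?case by (simp add: eval_word_def)
next
  case (Cons l w)
  have entry: "(M * N) $$ (i, j) = (\<Sum>k<n. M $$ (i, k) * N $$ (k, j))"
    if "M \<in> carrier_mat n n" "N \<in> carrier_mat n n" for M N :: "real mat"
    using that Cons.prems by (auto simp: scalar_prod_def atLeast0LessThan intro!: sum.cong)
  have letter: "((\<lambda>e. subst_letter (A e) (B e) l $$ (i, k)) \<longlongrightarrow> subst_letter A' B' l $$ (i, k)) F"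
    if "k < n" for k
    using A B that Cons.prems by (cases l) auto
  show ?case
    unfolding eval_word_Cons
      entry[OF subst_letter_carrier[OF cA cB] eval_word_carrier[OF cA cB]]
      entry[OF subst_letter_carrier[OF cA' cB'] eval_word_carrier[OF cA' cB']]
    by (intro tendsto_sum tendsto_mult letter Cons.IH) (use Cons.prems in auto)
qed

text \<open>The condition on the trace is open and the definite matrices are dense in the semidefinite
  ones: shifting both letters by \<open>e\<close> times the identity makes them definite, and the trace tends to
  its unshifted value as \<open>e\<close> tends to 0.\<close>
lemma negative_trace_from_semidef:
  assumes A: "sym_pos_semidef n A" and B: "sym_pos_semidef n B"
    and neg: "mat_trace (eval_word n w A B) < 0"
  shows "\<exists>A' B'. sym_pos_def n A' \<and> sym_pos_def n B' \<and> mat_trace (eval_word n w A' B') < 0"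
proof -
  define S where "S M e = M + e \<cdot>\<^sub>m 1\<^sub>m n" for M :: "real mat" and e :: real
  have cA: "A \<in> carrier_mat n n" and cB: "B \<in> carrier_mat n n"
    using A B by (auto simp: sym_pos_semidef_def)
  have cS: "S M e \<in> carrier_mat n n" if "M \<in> carrier_mat n n" for M e
    using that by (simp add: S_def)
  have limS: "((\<lambda>e. S M e $$ (i, j)) \<longlongrightarrow> M $$ (i, j)) (at_right 0)"
    if "M \<in> carrier_mat n n" "i < n" "j < n" for M i j
    using that by (auto simp: S_def intro!: tendsto_eq_intros)
  have tr: "mat_trace (eval_word n w P Q) = (\<Sum>i<n. eval_word n w P Q $$ (i, i))"
    if "P \<in> carrier_mat n n" "Q \<in> carrier_mat n n" for P Q
    using eval_word_carrier[OF that, of w] by (simp add: mat_trace_def)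
  have "((\<lambda>e. mat_trace (eval_word n w (S A e) (S B e))) \<longlongrightarrow> mat_trace (eval_word n w A B))
      (at_right 0)"
    unfolding tr[OF cS[OF cA] cS[OF cB]] tr[OF cA cB]
    by (intro tendsto_sum tendsto_eval_word_entry) (use cA cB cS limS in auto)
  from order_tendstoD(2)[OF this neg]
  have "eventually (\<lambda>e. mat_trace (eval_word n w (S A e) (S B e)) < 0 \<and> e > 0) (at_right 0)"
    using eventually_at_right_less by (rule eventually_conj)
  then obtain e where "mat_trace (eval_word n w (S A e) (S B e)) < 0" "e > 0"
    using eventually_happens trivial_limit_at_right_real by blast
  then show ?thesis
    using sym_pos_def_shift[OF A, of e] sym_pos_def_shift[OF B, of e] unfolding S_def by blast
qed

section \<open>The matrices with negative trace\<close>

text \<open>The left-hand side is the trace of the word for the matrices described at the top, with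
  \<open>N = 100\<close> and \<open>k = q - 1\<close>; its three coefficients are \<open>2\<close>, \<open>N\<^sup>2\<close> and \<open>5 N\<^sup>4\<close>.\<close>
lemma negative_form_value:
  fixes X Y t :: real
  assumes X: "X \<ge> 0" and XY: "4 * X \<le> Y" and Y: "Y > 0" and k: "k \<ge> 1" and p: "p \<ge> 2"
    and t: "t = 1 / 1000"
  shows "2 * (X ^ k + Y ^ k) - 10000 * (t + t ^ p) * (Y ^ k - 2 * X ^ k)
    + 500000000 * t ^ Suc p * (4 * X ^ k + Y ^ k) < 0"
proof -
  have "(4::real) ^ 1 \<le> 4 ^ k"
    by (rule power_increasing) (use k in auto)
  then have "4 * X ^ k \<le> 4 ^ k * X ^ k"
    using X by (intro mult_right_mono) auto
  also have "\<dots> = (4 * X) ^ k"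
    by (simp add: power_mult_distrib)
  also have "\<dots> \<le> Y ^ k"
    using X XY by (intro power_mono) auto
  finally have XYk: "4 * X ^ k \<le> Y ^ k" .
  \<comment> \<open>Hence, in units of \<open>Y ^ k\<close>, the three terms are at most \<open>5/2\<close>, \<open>-5\<close> and \<open>1\<close>.\<close>
  have Yk: "Y ^ k > 0" using Y by simp
  have Xk: "X ^ k \<ge> 0" using X by simp
  have tp0: "t ^ p \<ge> 0" using t by simp
  have "10 = 10000 * t" using t by simp
  also have "\<dots> \<le> 10000 * (t + t ^ p)" using tp0 by simp
  finally have tt: "10 \<le> 10000 * (t + t ^ p)" .
  have tp: "t ^ Suc p \<le> t ^ 3"
    by (rule power_decreasing) (use p t in auto)
  have "10 * (Y ^ k / 2) \<le> 10000 * (t + t ^ p) * (Y ^ k - 2 * X ^ k)"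
  proof (rule mult_mono[OF tt])
    show "Y ^ k / 2 \<le> Y ^ k - 2 * X ^ k" using XYk by linarith
    show "0 \<le> 10000 * (t + t ^ p)" using tt by (rule order_trans[rotated]) simp
    show "0 \<le> Y ^ k / 2" using Yk by simp
  qed
  moreover have "500000000 * t ^ Suc p * (4 * X ^ k + Y ^ k) \<le> (1 / 2) * (2 * Y ^ k)"
  proof (rule mult_mono)
    have "t ^ 3 = 1 / 1000000000" unfolding t by (simp add: power3_eq_cube)
    then show "500000000 * t ^ Suc p \<le> 1 / 2" using tp by linarith
    show "4 * X ^ k + Y ^ k \<le> 2 * Y ^ k" using XYk by linarith
    show "0 \<le> 4 * X ^ k + Y ^ k" using Xk Yk by linarith
  qed simp
  ultimately show ?thesis
    using XYk Yk Xk by argo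
qed

lemma sum_upto_3: "(\<Sum>i<3. f i) = f 0 + f 1 + f (2::nat)" for f :: "nat \<Rightarrow> real"
  by (simp add: numeral_3_eq_3 numeral_2_eq_2 lessThan_Suc)

theorem theorem1p10:
  fixes p q :: nat
  assumes "p \<ge> 2" and "q \<ge> 2"
  shows "\<exists>(n::nat) (A::real mat) (B::real mat).
           sym_pos_def n A \<and> sym_pos_def n B \<and>
           mat_trace (eval_word n (word_ABApBq p q) A B) < 0"
proof -
  define x y a :: "nat \<Rightarrow> real" where
    "x = (!) [1, - 200, 1]" and "y = (!) [1, 100, 19999]" and "a = (!) [1, 1 / 1000, 0]"
  define X Y where "X = (\<Sum>l<3. (x l)\<^sup>2)" and "Y = (\<Sum>l<3. (y l)\<^sup>2)"
  define t :: real where "t = 1 / 1000"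
  define B where "B = outer_sum 3 x y 1 1"
  obtain k where q: "q = Suc k" and k: "k \<ge> 1"
    using assms(2) by (cases q) auto
  have orth: "(\<Sum>l<3. x l * y l) = 0"
    by (simp add: sum_upto_3 x_def y_def)
  have XY: "X \<ge> 0" "4 * X \<le> Y" "Y > 0"
    by (simp_all add: X_def Y_def sum_upto_3 x_def y_def)
  have Bq: "B ^\<^sub>m q = outer_sum 3 x y (X ^ k) (Y ^ k)"
    unfolding B_def q X_def Y_def by (rule outer_sum_power[OF orth])
  have "mat_trace (eval_word 3 (word_ABApBq p q) (mat_diag 3 a) B)
      = (\<Sum>i<3. \<Sum>j<3. a i * a j ^ p * (B $$ (i, j) * (B ^\<^sub>m q) $$ (j, i)))"
    by (rule mat_trace_word_diag) (simp add: B_def)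
  also have "\<dots> = 2 * (X ^ k + Y ^ k) - 10000 * (t + t ^ p) * (Y ^ k - 2 * X ^ k)
      + 500000000 * t ^ Suc p * (4 * X ^ k + Y ^ k)"
    using assms(1) unfolding Bq
    by (simp add: B_def outer_sum_def sum_upto_3 x_def y_def a_def t_def algebra_simps
        zero_power power_divide add_divide_distrib diff_divide_distrib)
  also have "\<dots> < 0"
    by (rule negative_form_value) (use XY k assms(1) t_def in auto)
  finally have neg: "mat_trace (eval_word 3 (word_ABApBq p q) (mat_diag 3 a) B) < 0" .
  have A: "sym_pos_semidef 3 (mat_diag 3 a)"
    by (rule sym_pos_semidef_mat_diag) (auto simp: a_def less_Suc_eq numeral_3_eq_3)
  show ?thesis
    using negative_trace_from_semidef[OF A _ neg] sym_pos_semidef_outer_sum[of 3 x y]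
    unfolding B_def by blast
qed

end
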